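(* Let $X$ be a random vector in $\mathbb{R}^p$ and let $j\in\{1,\dots,p\}$. Assume additive innovation: for each $l\in\{1,\dots,p\}$ there exists a function $\nu_{-l}$ such that $X^l=\nu_{-l}(X^{-l})+\epsilon_l$ with $\epsilon_l$ independent of $X^{-l}$ and $\mathbb{E}[\epsilon_l]=0$. Suppose that the regressor $\widehat{\nu}_{-j}$ is consistent, i.e. $\mathbb{E}\left[\left(\widehat{\nu}_{-j}(X^{-j})-\nu_{-j}(X^{-j})\right)^2\right]\to 0$ as the training size goes to infinity. Then $\widetilde{x}'^{(j)}$, constructed by keeping all coordinates other than the $j$-th one and replacing the $j$-th coordinate by $\widehat{\nu}_{-j}(x^{-j})$ plus a permuted residual of $\widehat{\nu}_{-j}$, is sampled from $P'_j$, and $$\mathcal{W}_2(P'_j,P^\star_j)\to 0 .$$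
   Context: For a vector $x\in\mathbb{R}^p$, $x^j$ is its $j$-th coordinate and $x^{-j}\in\mathbb{R}^{p-1}$ is $x$ with the $j$-th coordinate removed. Under additive innovation $\nu_{-j}(X^{-j})=\mathbb{E}[X^j\mid X^{-j}]$; $\widehat{\nu}_{-j}$ is an estimate of $\nu_{-j}$ obtained from a training sample independent of the data points considered. Construction of the empirical sampler: for the $i$-th observation $x_i$, the vector $\widetilde{x}'^{(j)}_i$ has coordinates $\widetilde{x}'^{(j)l}_i=x_i^l$ for $l\ne j$ and $\widetilde{x}'^{(j)j}_i=\widehat{\nu}_{-j}(x_i^{-j})+\{x^j-\widehat{\nu}_{-j}(x^{-j})\}^{\mathrm{perm}}$, where the residuals $x^j-\widehat{\nu}_{-j}(x^{-j})$ are permuted across individuals, so that the added residual is that of another i.i.d. observation. $P'_j$ denotes the law of the vector $\widetilde{X}'^{(j)}$ with $\widetilde{X}'^{(j)-j}=X^{-j}$ and $\widetilde{X}'^{(j)j}=\widehat{\nu}_{-j}(X^{-j})+\left(X'^j-\widehat{\nu}_{-j}(X'^{-j})\right)$, where $X'$ is an independent copy of $X$. $P^\star_j$ denotes the law of the theoretical counterpart $\widetilde{X}^{(j)}$, given by $\widetilde{X}^{(j)-j}=X^{-j}$ and $\widetilde{X}^{(j)j}$ drawn from the conditional law of $X^j$ given $X^{-j}$, independently of $X^j$ conditionally on $X^{-j}$ (equivalently, under additive innovation, $\nu_{-j}(X^{-j})+(X'^j-\nu_{-j}(X'^{-j}))$). $\mathcal{W}_2$ is the 2-Wasserstein distance.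 *)

theory Defs
  imports "HOL-Probability.Probability" "HOL-Combinatorics.Permutations"
begin

section \<open>Random vectors with one coordinate removed\<close>

text \<open>
  Vectors of \<open>\<real>\<^sup>p\<close> are elements of \<^typ>\<open>real ^ 'p\<close>. The vector \<open>x\<close> with its \<open>j\<close>-th coordinate
  removed is the family \<open>(x $ l)\<close> indexed by \<open>l \<noteq> j\<close>, that is, an extensional function on
  \<open>UNIV - {j}\<close>, and \<open>\<real>\<^bsup>p-1\<^esup>\<close> is the corresponding finite product of Borel lines.
\<close>

definition others :: "'p::finite \<Rightarrow> ('p \<Rightarrow> real) measure" where
  "others j = Pi\<^sub>M (UNIV - {j}) (\<lambda>_. borel)"

definition drop_coord :: "'p::finite \<Rightarrow> real ^ 'p \<Rightarrow> ('p \<Rightarrow> real)" where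
  "drop_coord j x = restrict (\<lambda>l. x $ l) (UNIV - {j})"

definition set_coord :: "'p::finite \<Rightarrow> real ^ 'p \<Rightarrow> real \<Rightarrow> real ^ 'p" where
  "set_coord j x a = (\<chi> l. if l = j then a else x $ l)"

text \<open>
  Independence of two random elements with values in arbitrary measurable spaces
  (\<^const>\<open>prob_space.indep_var\<close> requires both to have the same value type): the sigma-algebras
  they generate are independent.
\<close>

definition indep_elements ::
  "'w measure \<Rightarrow> 'a measure \<Rightarrow> ('w \<Rightarrow> 'a) \<Rightarrow> 'b measure \<Rightarrow> ('w \<Rightarrow> 'b) \<Rightarrow> bool" where
  "indep_elements M N A L B \<longleftrightarrow>
     A \<in> measurable M N \<and> B \<in> measurable M L \<and>
     prob_space.indep_set M (sets (vimage_algebra (space M) A N))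
                            (sets (vimage_algebra (space M) B L))"

definition additive_innovation ::
  "'w measure \<Rightarrow> ('w \<Rightarrow> real ^ 'p::finite) \<Rightarrow> ('p \<Rightarrow> ('p \<Rightarrow> real) \<Rightarrow> real) \<Rightarrow> ('p \<Rightarrow> 'w \<Rightarrow> real) \<Rightarrow> bool"
where
  "additive_innovation M X \<nu> \<epsilon> \<longleftrightarrow>
     (\<forall>l. \<nu> l \<in> borel_measurable (others l) \<and>
          (\<forall>\<omega>\<in>space M. X \<omega> $ l = \<nu> l (drop_coord l (X \<omega>)) + \<epsilon> l \<omega>) \<and>
          indep_elements M borel (\<epsilon> l) (others l) (\<lambda>\<omega>. drop_coord l (X \<omega>)) \<and>
          integrable M (\<epsilon> l) \<and> prob_space.expectation M (\<epsilon> l) = 0)"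


section \<open>The theoretical sampler\<close>

text \<open>\<open>\<kappa>\<close> is a regular version of the conditional law of \<open>X\<^sup>j\<close> given \<open>X\<^bsup>-j\<^esup>\<close>.\<close>

definition regular_conditional_law ::
  "'w measure \<Rightarrow> ('w \<Rightarrow> real ^ 'p::finite) \<Rightarrow> 'p \<Rightarrow> (('p \<Rightarrow> real) \<Rightarrow> real measure) \<Rightarrow> bool" where
  "regular_conditional_law M X j \<kappa> \<longleftrightarrow>
     \<kappa> \<in> measurable (others j) (prob_algebra borel) \<and>
     (\<forall>A\<in>sets (others j). \<forall>B\<in>sets borel.
        emeasure M {\<omega>\<in>space M. drop_coord j (X \<omega>) \<in> A \<and> X \<omega> $ j \<in> B} =
        (\<integral>\<^sup>+\<omega>. emeasure (\<kappa> (drop_coord j (X \<omega>))) B * indicator A (drop_coord j (X \<omega>)) \<partial>M))"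

text \<open>
  The law \<open>P\<^sup>\<star>\<^sub>j\<close>: draw \<open>x\<close> from the law \<open>\<mu>\<close> of \<open>X\<close> and replace its \<open>j\<close>-th coordinate by a draw
  from the conditional law at \<open>x\<^bsup>-j\<^esup>\<close>. The second draw depends on \<open>x\<close> only through \<open>x\<^bsup>-j\<^esup>\<close>, so
  it is conditionally independent of \<open>x\<^sup>j\<close>.
\<close>

definition theoretical_law ::
  "(real ^ 'p::finite) measure \<Rightarrow> 'p \<Rightarrow> (('p \<Rightarrow> real) \<Rightarrow> real measure) \<Rightarrow> (real ^ 'p) measure" where
  "theoretical_law \<mu> j \<kappa> = \<mu> \<bind> (\<lambda>x. distr (\<kappa> (drop_coord j x)) borel (set_coord j x))"


section \<open>The empirical sampler\<close>

text \<open>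
  A training sample of size \<open>n\<close> is an \<open>n\<close>-tuple of observations in a measurable space \<open>S\<close>. For an
  estimator \<open>f\<close>, \<open>f t\<close> is the regression function fitted on the training sample \<open>t\<close>.
\<close>

definition training_space :: "'s measure \<Rightarrow> nat \<Rightarrow> (nat \<Rightarrow> 's) measure" where
  "training_space S n = Pi\<^sub>M {..<n} (\<lambda>_. S)"

text \<open>Keep \<open>x\<^bsup>-j\<^esup>\<close>, and add to the prediction \<open>g x\<^bsup>-j\<^esup>\<close> the residual of \<open>x'\<close>.\<close>

definition residual_swap ::
  "'p::finite \<Rightarrow> (('p \<Rightarrow> real) \<Rightarrow> real) \<Rightarrow> real ^ 'p \<Rightarrow> real ^ 'p \<Rightarrow> real ^ 'p" where
  "residual_swap j g x x' =
     set_coord j x (g (drop_coord j x) + (x' $ j - g (drop_coord j x')))"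

text \<open>
  The law \<open>P'\<^sub>j\<close>, for a training sample of law \<open>\<tau>\<close> and two independent vectors of law \<open>\<mu>\<close>,
  independent of the training sample.
\<close>

definition empirical_law ::
  "'t measure \<Rightarrow> (real ^ 'p::finite) measure \<Rightarrow> 'p \<Rightarrow> ('t \<Rightarrow> ('p \<Rightarrow> real) \<Rightarrow> real) \<Rightarrow> (real ^ 'p) measure"
where
  "empirical_law \<tau> \<mu> j f =
     distr (\<tau> \<Otimes>\<^sub>M (\<mu> \<Otimes>\<^sub>M \<mu>)) borel (\<lambda>(t, x, x'). residual_swap j (f t) x x')"


section \<open>The 2-Wasserstein distance\<close>

definition couplings ::
  "'a::{metric_space, second_countable_topology} measure \<Rightarrow> 'a measure \<Rightarrow> ('a \<times> 'a) measure set" where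
  "couplings P Q =
     {\<gamma>. prob_space \<gamma> \<and> sets \<gamma> = sets (borel \<Otimes>\<^sub>M borel) \<and>
         distr \<gamma> borel fst = P \<and> distr \<gamma> borel snd = Q}"

definition ennreal_sqrt :: "ennreal \<Rightarrow> ennreal" where
  "ennreal_sqrt c = (if c = \<infinity> then \<infinity> else ennreal (sqrt (enn2real c)))"

text \<open>Extended-valued, so that it is meaningful without any moment assumption.\<close>

definition wasserstein2 ::
  "'a::{metric_space, second_countable_topology} measure \<Rightarrow> 'a measure \<Rightarrow> ennreal" where
  "wasserstein2 P Q =
     ennreal_sqrt (INF \<gamma>\<in>couplings P Q. \<integral>\<^sup>+z. ennreal ((dist (fst z) (snd z))\<^sup>2) \<partial>\<gamma>)"

end

theory Submission
  imports Defs
begin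

text \<open>
  Both claims are statements about images of product measures. Write \<open>\<mu>\<close> for the law of \<open>X\<close> and
  \<open>\<tau>\<close> for the law of the training sample.

  Sampling: independence makes the joint law of the permutation, the training sample and the
  observations the product of the three laws. For each fixed permutation \<open>\<pi>\<close> with \<open>\<pi> i \<noteq> i\<close>, the
  pair formed by observations \<open>i\<close> and \<open>\<pi> i\<close> has law \<open>\<mu> \<otimes> \<mu>\<close> (lemma \<open>distr_PiM_pair\<close>), so the
  sampled vector has the law \<open>P'\<^sub>j\<close> whatever the value of \<open>\<pi>\<close>
  (lemma \<open>residual_swap_permuted_law\<close>).

  Convergence: disintegrating along \<open>X\<^bsup>-j\<^esup>\<close> shows that \<open>P\<^sup>\<star>\<^sub>j\<close> is \<open>\<mu>\<close> itself
  (lemma \<open>theoretical_law_eq\<close>). With the true regression function the residual of the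
  independent copy is the innovation, which is independent of \<open>X\<^bsup>-j\<^esup>\<close>, so that \<open>residual_swap j (\<nu> j)\<close>
  also maps \<open>\<mu> \<otimes> \<mu>\<close> to \<open>\<mu>\<close> (lemma \<open>residual_swap_innovation_law\<close>). Applying the swap with the
  estimate and the swap with \<open>\<nu> j\<close> to the same pair therefore couples \<open>P'\<^sub>j\<close> with \<open>P\<^sup>\<star>\<^sub>j\<close>. The two
  outputs differ only in coordinate \<open>j\<close>, by a difference of two estimation errors, and
  \<open>(a - b)\<^sup>2 \<le> 2 a\<^sup>2 + 2 b\<^sup>2\<close> bounds the transport cost by four times the mean squared error
  (lemma \<open>wasserstein2_empirical_le\<close>).
\<close>

section \<open>Product measures and independence\<close>

lemma measure_eqI_rectangles:
  assumes "prob_space P" and P: "sets P = sets (N \<Otimes>\<^sub>M L)" and Q: "sets Q = sets (N \<Otimes>\<^sub>M L)"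
    and eq: "\<And>a b. a \<in> sets N \<Longrightarrow> b \<in> sets L \<Longrightarrow> emeasure P (a \<times> b) = emeasure Q (a \<times> b)"
  shows "P = Q"
proof (rule measure_eqI_generator_eq[OF Int_stable_pair_measure_generator[of N L],
      where \<Omega> = "space N \<times> space L" and A = "\<lambda>_. space N \<times> space L"])
  interpret P: prob_space P by fact
  show "{a \<times> b |a b. a \<in> sets N \<and> b \<in> sets L} \<subseteq> Pow (space N \<times> space L)"
    by (rule pair_measure_closed)
  show "sets P = sigma_sets (space N \<times> space L) {a \<times> b |a b. a \<in> sets N \<and> b \<in> sets L}"
    "sets Q = sigma_sets (space N \<times> space L) {a \<times> b |a b. a \<in> sets N \<and> b \<in> sets L}"
    using P Q by (simp_all add: sets_pair_measure)
qed (use eq prob_space.emeasure_space_1[OF assms(1)] sets_eq_imp_space_eq[OF P]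
      in \<open>auto simp: space_pair_measure\<close>)

lemma indep_elements_distr_pair:
  assumes "prob_space M" and indep: "indep_elements M N A L B"
  shows "distr M (N \<Otimes>\<^sub>M L) (\<lambda>\<omega>. (A \<omega>, B \<omega>)) = distr M N A \<Otimes>\<^sub>M distr M L B"
proof -
  interpret prob_space M by fact
  have A[measurable]: "A \<in> measurable M N" and B[measurable]: "B \<in> measurable M L"
    and ind: "indep_set (sets (vimage_algebra (space M) A N)) (sets (vimage_algebra (space M) B L))"
    using indep by (auto simp: indep_elements_def)
  interpret DA: prob_space "distr M N A" by (rule prob_space_distr) fact
  interpret DB: prob_space "distr M L B" by (rule prob_space_distr) fact
  show ?thesis
  proof (rule pair_measure_eqI[symmetric])
    fix a b assume "a \<in> sets (distr M N A)" "b \<in> sets (distr M L B)"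
    then have a[measurable]: "a \<in> sets N" and b[measurable]: "b \<in> sets L" by auto
    have "(\<lambda>\<omega>. (A \<omega>, B \<omega>)) -` (a \<times> b) \<inter> space M = (A -` a \<inter> space M) \<inter> (B -` b \<inter> space M)"
      by auto
    moreover have "prob ((A -` a \<inter> space M) \<inter> (B -` b \<inter> space M))
        = prob (A -` a \<inter> space M) * prob (B -` b \<inter> space M)"
      by (intro indep_setD[OF ind] in_vimage_algebra a b)
    ultimately show "emeasure (distr M N A) a * emeasure (distr M L B) b
        = emeasure (distr M (N \<Otimes>\<^sub>M L) (\<lambda>\<omega>. (A \<omega>, B \<omega>))) (a \<times> b)"
      by (simp add: emeasure_distr emeasure_eq_measure ennreal_mult)
  qed (unfold_locales, auto intro: sets_pair_measure_cong)
qed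

lemma distr_PiM_pair:
  assumes "prob_space \<mu>" and "i \<in> I" "k \<in> I" "i \<noteq> k"
  shows "distr (Pi\<^sub>M I (\<lambda>_. \<mu>)) (\<mu> \<Otimes>\<^sub>M \<mu>) (\<lambda>y. (y i, y k)) = \<mu> \<Otimes>\<^sub>M \<mu>"
proof -
  interpret \<mu>: prob_space \<mu> by fact
  interpret product_prob_space "\<lambda>_. \<mu>" I by unfold_locales
  have [measurable]: "(\<lambda>y. y i) \<in> measurable (Pi\<^sub>M I (\<lambda>_. \<mu>)) \<mu>"
    "(\<lambda>y. y k) \<in> measurable (Pi\<^sub>M I (\<lambda>_. \<mu>)) \<mu>"
    using assms by (auto intro: measurable_component_singleton)
  show ?thesis
  proof (rule pair_measure_eqI[symmetric])
    fix a b assume [measurable]: "a \<in> sets \<mu>" "b \<in> sets \<mu>"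
    have "(\<lambda>y. (y i, y k)) -` (a \<times> b) \<inter> space (Pi\<^sub>M I (\<lambda>_. \<mu>))
        = {y\<in>space (Pi\<^sub>M I (\<lambda>_. \<mu>)). \<forall>l\<in>{i, k}. y l \<in> (if l = i then a else b)}"
      using assms by auto
    moreover have "emeasure (Pi\<^sub>M I (\<lambda>_. \<mu>))
        {y\<in>space (Pi\<^sub>M I (\<lambda>_. \<mu>)). \<forall>l\<in>{i, k}. y l \<in> (if l = i then a else b)}
        = (\<Prod>l\<in>{i, k}. emeasure \<mu> (if l = i then a else b))"
      using assms by (intro emeasure_PiM_Collect) auto
    ultimately show "emeasure \<mu> a * emeasure \<mu> b
        = emeasure (distr (Pi\<^sub>M I (\<lambda>_. \<mu>)) (\<mu> \<Otimes>\<^sub>M \<mu>) (\<lambda>y. (y i, y k))) (a \<times> b)"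
      using assms by (simp add: emeasure_distr)
  qed (unfold_locales, simp)
qed

lemma distr_pair_prob_snd:
  assumes "prob_space M" "sigma_finite_measure N"
  shows "distr (M \<Otimes>\<^sub>M N) N snd = N"
proof -
  interpret M: prob_space M by fact
  interpret N: sigma_finite_measure N by fact
  interpret pair_sigma_finite N M ..
  have "N = distr (N \<Otimes>\<^sub>M M) N fst"
    by (rule M.distr_pair_fst[symmetric])
  also have "N \<Otimes>\<^sub>M M = distr (M \<Otimes>\<^sub>M N) (N \<Otimes>\<^sub>M M) (\<lambda>(x, y). (y, x))"
    by (rule distr_pair_swap)
  finally show ?thesis
    by (simp add: distr_distr comp_def case_prod_beta)
qed

section \<open>Removing and replacing a coordinate\<close>

text \<open>The vector whose \<open>j\<close>-th coordinate is \<open>a\<close> and whose other coordinates are given by \<open>d\<close>.\<close>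

definition join_coord :: "'p::finite \<Rightarrow> ('p \<Rightarrow> real) \<times> real \<Rightarrow> real ^ 'p" where
  "join_coord j = (\<lambda>(d, a). \<chi> l. if l = j then a else d l)"

lemma set_coord_eq_join: "set_coord j x a = join_coord j (drop_coord j x, a)"
  by (simp add: set_coord_def join_coord_def drop_coord_def vec_eq_iff)

lemma join_coord_drop: "join_coord j (drop_coord j x, x $ j) = x"
  by (simp add: join_coord_def drop_coord_def vec_eq_iff)

lemma borel_measurable_vecI:
  fixes f :: "'a \<Rightarrow> real ^ 'p::finite"
  assumes "\<And>l. (\<lambda>x. f x $ l) \<in> borel_measurable M"
  shows "f \<in> borel_measurable M"
proof (subst borel_measurable_euclidean_space, intro ballI)
  fix b :: "real ^ 'p" assume "b \<in> Basis"
  then obtain l where "b = axis l 1"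
    by (auto simp: Basis_vec_def)
  then show "(\<lambda>x. f x \<bullet> b) \<in> borel_measurable M"
    using assms by (simp add: inner_axis)
qed

lemma measurable_join_coord [measurable]: "join_coord j \<in> borel_measurable (others j \<Otimes>\<^sub>M borel)"
proof (rule borel_measurable_vecI)
  fix l
  show "(\<lambda>z. join_coord j z $ l) \<in> borel_measurable (others j \<Otimes>\<^sub>M borel)"
  proof (cases "l = j")
    case False
    then have [measurable]: "(\<lambda>d. d l) \<in> borel_measurable (others j)"
      unfolding others_def by (intro measurable_component_singleton) auto
    show ?thesis
      using False by (simp add: join_coord_def case_prod_beta)
  qed (simp add: join_coord_def case_prod_beta)
qed

lemma measurable_drop_coord [measurable]: "drop_coord j \<in> measurable borel (others j)"
  unfolding others_def drop_coord_def by (intro measurable_restrict) simp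

lemma borel_measurable_vec_nth [measurable (raw)]:
  fixes f :: "'a \<Rightarrow> real ^ 'p::finite"
  shows "f \<in> borel_measurable M \<Longrightarrow> (\<lambda>\<omega>. f \<omega> $ l) \<in> borel_measurable M"
  by (rule measurable_compose[OF _ borel_measurable_nth])

text \<open>Joint measurability in the training sample and in both observations.\<close>

lemma measurable_residual_swap:
  assumes [measurable]: "case_prod f \<in> borel_measurable (S \<Otimes>\<^sub>M others j)"
    and [measurable]: "t \<in> measurable M S" "x \<in> borel_measurable M" "x' \<in> borel_measurable M"
  shows "(\<lambda>\<omega>. residual_swap j (f (t \<omega>)) (x \<omega>) (x' \<omega>)) \<in> borel_measurable M"
  unfolding residual_swap_def set_coord_eq_join by measurable

section \<open>The law of the theoretical sampler\<close>

text \<open>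
  A draw from the conditional law at \<open>X\<^bsup>-j\<^esup>\<close> has, jointly with \<open>X\<^bsup>-j\<^esup>\<close>, the law of \<open>X\<close> itself.
\<close>

lemma theoretical_law_eq:
  fixes X :: "'w \<Rightarrow> real ^ 'p::finite"
  assumes "prob_space M" and X[measurable]: "X \<in> borel_measurable M"
    and cond: "regular_conditional_law M X j \<kappa>"
  shows "theoretical_law (distr M borel X) j \<kappa> = distr M borel X"
proof -
  interpret prob_space M by fact
  have \<kappa>: "\<kappa> \<in> measurable (others j) (prob_algebra borel)"
    and rect: "\<And>A B. A \<in> sets (others j) \<Longrightarrow> B \<in> sets borel \<Longrightarrow>
        emeasure M {\<omega>\<in>space M. drop_coord j (X \<omega>) \<in> A \<and> X \<omega> $ j \<in> B} =
        (\<integral>\<^sup>+\<omega>. emeasure (\<kappa> (drop_coord j (X \<omega>))) B * indicator A (drop_coord j (X \<omega>)) \<partial>M)"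
    using cond by (auto simp: regular_conditional_law_def)
  have [measurable]: "\<kappa> \<in> measurable (others j) (subprob_algebra borel)"
    by (rule measurable_prob_algebraD[OF \<kappa>])
  have sets_\<kappa>: "sets (\<kappa> d) = sets borel" if "d \<in> space (others j)" for d
    using measurable_space[OF \<kappa> that] by (simp add: space_prob_algebra)
  have drop: "drop_coord j x \<in> space (others j)" for x
    using measurable_space[OF measurable_drop_coord, of x] by simp
  define D where "D = distr M (others j) (\<lambda>\<omega>. drop_coord j (X \<omega>))"
  define K where "K = D \<bind> (\<lambda>d. distr (\<kappa> d) (others j \<Otimes>\<^sub>M borel) (Pair d))"
  have D_ne: "space D \<noteq> {}"
    using drop by (auto simp: D_def)
  have kern: "(\<lambda>d. distr (\<kappa> d) (others j \<Otimes>\<^sub>M borel) (Pair d))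
      \<in> measurable D (subprob_algebra (others j \<Otimes>\<^sub>M borel))"
    unfolding D_def by (rule measurable_distr2[where M = borel]) simp_all
  have emeasure_K: "emeasure K C = (\<integral>\<^sup>+\<omega>. emeasure (\<kappa> (drop_coord j (X \<omega>)))
        (Pair (drop_coord j (X \<omega>)) -` C) \<partial>M)" if C[measurable]: "C \<in> sets (others j \<Otimes>\<^sub>M borel)" for C
  proof -
    have "emeasure K C = (\<integral>\<^sup>+d. emeasure (distr (\<kappa> d) (others j \<Otimes>\<^sub>M borel) (Pair d)) C \<partial>D)"
      unfolding K_def by (rule emeasure_bind[OF D_ne kern C])
    also have "\<dots> = (\<integral>\<^sup>+\<omega>. emeasure (distr (\<kappa> (drop_coord j (X \<omega>))) (others j \<Otimes>\<^sub>M borel)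
        (Pair (drop_coord j (X \<omega>)))) C \<partial>M)"
      using measurable_emeasure_kernel[OF kern C] unfolding D_def
      by (intro nn_integral_distr) (simp_all add: D_def)
    also have "\<dots> = (\<integral>\<^sup>+\<omega>. emeasure (\<kappa> (drop_coord j (X \<omega>))) (Pair (drop_coord j (X \<omega>)) -` C) \<partial>M)"
    proof (rule nn_integral_cong)
      fix \<omega>
      have "space (\<kappa> (drop_coord j (X \<omega>))) = UNIV"
        using sets_eq_imp_space_eq[OF sets_\<kappa>[OF drop]] by simp
      moreover have "Pair (drop_coord j (X \<omega>)) \<in> measurable (\<kappa> (drop_coord j (X \<omega>))) (others j \<Otimes>\<^sub>M borel)"
        using drop by (simp add: measurable_cong_sets[OF sets_\<kappa>[OF drop] refl])
      ultimately show "emeasure (distr (\<kappa> (drop_coord j (X \<omega>))) (others j \<Otimes>\<^sub>M borel)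
          (Pair (drop_coord j (X \<omega>)))) C
        = emeasure (\<kappa> (drop_coord j (X \<omega>))) (Pair (drop_coord j (X \<omega>)) -` C)"
        by (simp add: emeasure_distr C)
    qed
    finally show ?thesis .
  qed
  have joint: "distr M (others j \<Otimes>\<^sub>M borel) (\<lambda>\<omega>. (drop_coord j (X \<omega>), X \<omega> $ j)) = K"
  proof (rule measure_eqI_rectangles)
    show "prob_space (distr M (others j \<Otimes>\<^sub>M borel) (\<lambda>\<omega>. (drop_coord j (X \<omega>), X \<omega> $ j)))"
      by (rule prob_space_distr) simp
    show "sets K = sets (others j \<Otimes>\<^sub>M borel)"
      unfolding K_def by (rule sets_bind[OF _ D_ne]) simp
  next
    fix a :: "('p \<Rightarrow> real) set" and b :: "real set"
    assume ab[measurable]: "a \<in> sets (others j)" "b \<in> sets borel"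
    have "(\<lambda>\<omega>. (drop_coord j (X \<omega>), X \<omega> $ j)) -` (a \<times> b) \<inter> space M
        = {\<omega>\<in>space M. drop_coord j (X \<omega>) \<in> a \<and> X \<omega> $ j \<in> b}"
      by auto
    moreover have "emeasure (\<kappa> (drop_coord j (X \<omega>))) (Pair (drop_coord j (X \<omega>)) -` (a \<times> b))
        = emeasure (\<kappa> (drop_coord j (X \<omega>))) b * indicator a (drop_coord j (X \<omega>))" for \<omega>
      by (auto simp: indicator_def)
    ultimately show "emeasure (distr M (others j \<Otimes>\<^sub>M borel) (\<lambda>\<omega>. (drop_coord j (X \<omega>), X \<omega> $ j))) (a \<times> b)
        = emeasure K (a \<times> b)"
      by (simp add: emeasure_distr rect[OF ab] emeasure_K)
  qed simp
  have kern': "(\<lambda>x. distr (\<kappa> (drop_coord j x)) borel (set_coord j x))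
      \<in> measurable (distr M borel X) (subprob_algebra borel)"
    unfolding set_coord_eq_join[abs_def] by (rule measurable_distr2[where M = borel]) simp_all
  show ?thesis
  proof (rule measure_eqI)
    show "sets (theoretical_law (distr M borel X) j \<kappa>) = sets (distr M borel X)"
      unfolding theoretical_law_def by (subst sets_bind[where N = borel]) simp_all
  next
    fix A assume "A \<in> sets (theoretical_law (distr M borel X) j \<kappa>)"
    then have A[measurable]: "A \<in> sets borel"
      unfolding theoretical_law_def by (subst (asm) sets_bind[where N = borel]) simp_all
    have inner: "emeasure (distr (\<kappa> (drop_coord j x)) borel (set_coord j x)) A
        = emeasure (\<kappa> (drop_coord j x))
            (Pair (drop_coord j x) -` (join_coord j -` A \<inter> space (others j \<Otimes>\<^sub>M borel)))" for x
    proof -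
      have "set_coord j x \<in> measurable (\<kappa> (drop_coord j x)) borel"
        using drop unfolding set_coord_eq_join[abs_def] measurable_cong_sets[OF sets_\<kappa>[OF drop] refl]
        by measurable
      moreover have "set_coord j x -` A \<inter> space (\<kappa> (drop_coord j x))
          = Pair (drop_coord j x) -` (join_coord j -` A \<inter> space (others j \<Otimes>\<^sub>M borel))"
        using sets_eq_imp_space_eq[OF sets_\<kappa>[OF drop[of x]]] drop[of x]
        by (auto simp: set_coord_eq_join space_pair_measure)
      ultimately show ?thesis
        by (simp add: emeasure_distr)
    qed
    have "emeasure (theoretical_law (distr M borel X) j \<kappa>) A
        = (\<integral>\<^sup>+x. emeasure (distr (\<kappa> (drop_coord j x)) borel (set_coord j x)) A \<partial>distr M borel X)"
      unfolding theoretical_law_def by (rule emeasure_bind[OF _ kern' A]) simp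
    also have "\<dots> = (\<integral>\<^sup>+\<omega>. emeasure (distr (\<kappa> (drop_coord j (X \<omega>))) borel (set_coord j (X \<omega>))) A \<partial>M)"
      using measurable_emeasure_kernel[OF kern' A] by (intro nn_integral_distr) simp_all
    also have "\<dots> = emeasure K (join_coord j -` A \<inter> space (others j \<Otimes>\<^sub>M borel))"
      unfolding inner by (rule emeasure_K[symmetric]) simp
    also have "\<dots> = emeasure (distr M borel X) A"
      by (subst joint[symmetric])
        (auto simp: emeasure_distr join_coord_drop space_pair_measure drop intro!: arg_cong[where f = "emeasure M"])
    finally show "emeasure (theoretical_law (distr M borel X) j \<kappa>) A = emeasure (distr M borel X) A" .
  qed
qed

text \<open>
  Swapping the true innovation for an independent copy does not change the law of \<open>X\<close>.
\<close>

lemma residual_swap_innovation_law: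
  fixes X :: "'w \<Rightarrow> real ^ 'p::finite"
  assumes "prob_space M" and X[measurable]: "X \<in> borel_measurable M"
    and innovation: "additive_innovation M X \<nu> \<epsilon>"
  shows "distr (distr M borel X \<Otimes>\<^sub>M distr M borel X) borel (\<lambda>(x, x'). residual_swap j (\<nu> j) x x')
    = distr M borel X"
proof -
  interpret prob_space M by fact
  define \<mu> where "\<mu> = distr M borel X"
  define D where "D = distr M (others j) (\<lambda>\<omega>. drop_coord j (X \<omega>))"
  define E where "E = distr M borel (\<epsilon> j)"
  define H where "H = (\<lambda>(e, d). join_coord j (d, \<nu> j d + e))"
  have \<nu>[measurable]: "\<nu> j \<in> borel_measurable (others j)"
    and eq: "\<And>\<omega>. \<omega> \<in> space M \<Longrightarrow> X \<omega> $ j = \<nu> j (drop_coord j (X \<omega>)) + \<epsilon> j \<omega>"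
    and indep: "indep_elements M borel (\<epsilon> j) (others j) (\<lambda>\<omega>. drop_coord j (X \<omega>))"
    using innovation by (auto simp: additive_innovation_def)
  have [measurable]: "\<epsilon> j \<in> borel_measurable M"
    using indep by (simp add: indep_elements_def)
  have [measurable]: "H \<in> borel_measurable (borel \<Otimes>\<^sub>M others j)"
    unfolding H_def by measurable
  interpret \<mu>: prob_space \<mu> unfolding \<mu>_def by (rule prob_space_distr) simp
  interpret D: prob_space D unfolding D_def by (rule prob_space_distr) simp
  have D_eq: "D = distr \<mu> (others j) (drop_coord j)"
    by (simp add: D_def \<mu>_def distr_distr comp_def)
  have E_eq: "E = distr \<mu> borel (\<lambda>x. x $ j - \<nu> j (drop_coord j x))"
    unfolding E_def \<mu>_def by (subst distr_distr) (auto simp: comp_def eq intro!: distr_cong)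
  have [measurable_cong]: "sets \<mu> = sets borel" by (simp add: \<mu>_def)
  interpret \<mu>\<mu>: pair_sigma_finite \<mu> \<mu> ..
  \<comment> \<open>Independence splits the law of \<open>(\<epsilon>\<^sub>j, X\<^bsup>-j\<^esup>)\<close> into factors carried by separate copies of \<open>X\<close>:
    the residual comes from \<open>x'\<close> and the kept coordinates from \<open>x\<close>.\<close>
  have "\<mu> = distr M borel (\<lambda>\<omega>. H (\<epsilon> j \<omega>, drop_coord j (X \<omega>)))"
    unfolding \<mu>_def by (rule distr_cong) (auto simp: H_def join_coord_drop simp flip: eq)
  also have "\<dots> = distr (distr M (borel \<Otimes>\<^sub>M others j) (\<lambda>\<omega>. (\<epsilon> j \<omega>, drop_coord j (X \<omega>)))) borel H"
    by (simp add: distr_distr comp_def)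
  also have "\<dots> = distr (E \<Otimes>\<^sub>M D) borel H"
    by (simp add: indep_elements_distr_pair[OF assms(1) indep] E_def D_def)
  also have "E \<Otimes>\<^sub>M D = distr (\<mu> \<Otimes>\<^sub>M \<mu>) (borel \<Otimes>\<^sub>M others j)
      (\<lambda>(x', x). (x' $ j - \<nu> j (drop_coord j x'), drop_coord j x))"
    unfolding D_eq E_eq using D.sigma_finite_measure_axioms
    by (intro pair_measure_distr) (simp_all add: D_eq)
  also have "distr \<dots> borel H = distr (\<mu> \<Otimes>\<^sub>M \<mu>) borel (\<lambda>(x', x). residual_swap j (\<nu> j) x x')"
    by (subst distr_distr, measurable)
      (simp add: H_def residual_swap_def set_coord_eq_join comp_def case_prod_unfold)
  also have "\<dots> = distr (distr (\<mu> \<Otimes>\<^sub>M \<mu>) (\<mu> \<Otimes>\<^sub>M \<mu>) (\<lambda>(x, y). (y, x))) borel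
      (\<lambda>(x', x). residual_swap j (\<nu> j) x x')"
    using \<mu>\<mu>.distr_pair_swap by simp
  also have "\<dots> = distr (\<mu> \<Otimes>\<^sub>M \<mu>) borel (\<lambda>(x, x'). residual_swap j (\<nu> j) x x')"
  proof (subst distr_distr)
    show "(\<lambda>(x', x). residual_swap j (\<nu> j) x x') \<in> borel_measurable (\<mu> \<Otimes>\<^sub>M \<mu>)"
      unfolding residual_swap_def set_coord_eq_join by measurable
  qed (simp_all add: comp_def case_prod_unfold)
  finally show ?thesis
    by (simp add: \<mu>_def)
qed

section \<open>The law of the permuted sampler\<close>

text \<open>
  The index \<open>\<sigma> \<omega> i\<close> of the borrowed residual is random, but it differs from \<open>i\<close> almost surely and
  is independent of the data, so conditioning on \<open>\<sigma>\<close> reduces the claim to a fixed index \<open>k \<noteq> i\<close>.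
\<close>

lemma residual_swap_permuted_law:
  fixes X :: "'w \<Rightarrow> real ^ 'p::finite" and x :: "nat \<Rightarrow> 'w \<Rightarrow> real ^ 'p"
  assumes "prob_space M" and X[measurable]: "X \<in> borel_measurable M"
    and f[measurable]: "case_prod f \<in> borel_measurable (S \<Otimes>\<^sub>M others j)"
    and indep: "prob_space.indep_vars M (\<lambda>_. borel) x {..<m}"
    and law: "\<forall>k<m. distr M borel (x k) = distr M borel X"
    and train: "indep_elements M S T (Pi\<^sub>M {..<m} (\<lambda>_. borel)) (\<lambda>\<omega>. \<lambda>k\<in>{..<m}. x k \<omega>)"
    and perm: "indep_elements M (count_space {\<pi>. \<pi> permutes {..<m}}) \<sigma>
          (S \<Otimes>\<^sub>M Pi\<^sub>M {..<m} (\<lambda>_. borel)) (\<lambda>\<omega>. (T \<omega>, \<lambda>k\<in>{..<m}. x k \<omega>))"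
    and i: "i < m" and moved: "AE \<omega> in M. \<sigma> \<omega> i \<noteq> i"
  shows "distr M borel (\<lambda>\<omega>. residual_swap j (f (T \<omega>)) (x i \<omega>) (x (\<sigma> \<omega> i) \<omega>))
    = empirical_law (distr M S T) (distr M borel X) j f"
proof -
  interpret prob_space M by fact
  define \<Theta> where "\<Theta> = count_space {\<pi>. \<pi> permutes {..<m}}"
  define \<mu> where "\<mu> = distr M borel X"
  define \<tau> where "\<tau> = distr M S T"
  define V where "V = Pi\<^sub>M {..<m} (\<lambda>_. \<mu>)"
  define h where "h = (\<lambda>(\<pi> :: nat \<Rightarrow> nat, t, y :: nat \<Rightarrow> real ^ 'p). residual_swap j (f t) (y i) (y (\<pi> i)))"
  have [measurable_cong]: "sets \<mu> = sets borel" by (simp add: \<mu>_def)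
  have [measurable_cong]: "sets \<tau> = sets S" by (simp add: \<tau>_def)
  have T[measurable]: "T \<in> measurable M S"
    using train by (simp add: indep_elements_def)
  have \<sigma>[measurable]: "\<sigma> \<in> measurable M \<Theta>"
    using perm by (simp add: indep_elements_def \<Theta>_def)
  have x[measurable]: "x k \<in> borel_measurable M" if "k < m" for k
    using indep that by (auto simp: indep_vars_def)
  have y[measurable]: "(\<lambda>\<omega>. \<lambda>k\<in>{..<m}. x k \<omega>) \<in> measurable M (Pi\<^sub>M {..<m} (\<lambda>_. borel))"
    using train by (simp add: indep_elements_def)
  interpret \<mu>: prob_space \<mu> unfolding \<mu>_def by (rule prob_space_distr) simp
  interpret \<tau>: prob_space \<tau> unfolding \<tau>_def by (rule prob_space_distr) simp
  interpret law_\<sigma>: prob_space "distr M \<Theta> \<sigma>" by (rule prob_space_distr) simp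
  interpret V: prob_space V unfolding V_def by (rule prob_space_PiM) unfold_locales
  interpret \<mu>\<mu>: pair_prob_space \<mu> \<mu> ..
  interpret \<tau>V: pair_prob_space \<tau> V ..
  have sets_V[measurable_cong]: "sets V = sets (Pi\<^sub>M {..<m} (\<lambda>_. borel))"
    unfolding V_def by (rule sets_PiM_cong) (simp_all add: \<mu>_def)
  have "distr M (Pi\<^sub>M {..<m} (\<lambda>_. borel)) (\<lambda>\<omega>. \<lambda>k\<in>{..<m}. x k \<omega>)
      = Pi\<^sub>M {..<m} (\<lambda>k. distr M borel (x k))"
    using indep i by (subst indep_vars_iff_distr_eq_PiM'[symmetric]) auto
  also have "\<dots> = V"
    unfolding V_def \<mu>_def using law by (intro PiM_cong) auto
  finally have law_y: "distr M (Pi\<^sub>M {..<m} (\<lambda>_. borel)) (\<lambda>\<omega>. \<lambda>k\<in>{..<m}. x k \<omega>) = V" .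
  have joint: "distr M (\<Theta> \<Otimes>\<^sub>M (S \<Otimes>\<^sub>M Pi\<^sub>M {..<m} (\<lambda>_. borel))) (\<lambda>\<omega>. (\<sigma> \<omega>, T \<omega>, \<lambda>k\<in>{..<m}. x k \<omega>))
      = distr M \<Theta> \<sigma> \<Otimes>\<^sub>M (\<tau> \<Otimes>\<^sub>M V)"
    using indep_elements_distr_pair[OF assms(1) perm] indep_elements_distr_pair[OF assms(1) train]
    by (simp add: \<Theta>_def \<tau>_def law_y)
  have fixed: "(\<lambda>(t, y). residual_swap j (f t) (y i) (y k))
      \<in> borel_measurable (S \<Otimes>\<^sub>M Pi\<^sub>M {..<m} (\<lambda>_. borel))" if "k < m" for k
    unfolding case_prod_beta using that i
    by (intro measurable_residual_swap[OF f])
      (auto intro!: measurable_compose[OF measurable_snd] measurable_component_singleton)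
  have "countable {\<pi>. \<pi> permutes {..<m}}"
    by (simp add: countable_finite finite_permutations)
  then have h[measurable]: "h \<in> borel_measurable (\<Theta> \<Otimes>\<^sub>M (S \<Otimes>\<^sub>M Pi\<^sub>M {..<m} (\<lambda>_. borel)))"
    unfolding \<Theta>_def
  proof (intro measurable_pair_measure_countable1)
    fix \<pi> assume "\<pi> \<in> {\<pi>. \<pi> permutes {..<m}}"
    then have "\<pi> i < m"
      using i permutes_in_image[of \<pi> "{..<m}" i] by simp
    from fixed[OF this] show "(\<lambda>y. h (\<pi>, y)) \<in> borel_measurable (S \<Otimes>\<^sub>M Pi\<^sub>M {..<m} (\<lambda>_. borel))"
      by (simp add: h_def case_prod_beta)
  qed
  \<comment> \<open>With \<open>k = \<pi> i\<close>, this is the conditional law of the sampled vector given that the permutation is \<open>\<pi>\<close>.\<close>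
  have slice: "distr (\<tau> \<Otimes>\<^sub>M V) borel (\<lambda>(t, y). residual_swap j (f t) (y i) (y k)) = empirical_law \<tau> \<mu> j f"
    if k: "k < m" "k \<noteq> i" for k
  proof -
    have pairV: "distr V (\<mu> \<Otimes>\<^sub>M \<mu>) (\<lambda>y. (y i, y k)) = \<mu> \<Otimes>\<^sub>M \<mu>"
      unfolding V_def using i k by (intro distr_PiM_pair \<mu>.prob_space_axioms) auto
    have comp[measurable]: "(\<lambda>y. (y i, y k)) \<in> measurable V (\<mu> \<Otimes>\<^sub>M \<mu>)"
      unfolding V_def using i k by (intro measurable_Pair measurable_component_singleton) auto
    have "\<tau> \<Otimes>\<^sub>M (\<mu> \<Otimes>\<^sub>M \<mu>) = distr \<tau> \<tau> (\<lambda>t. t) \<Otimes>\<^sub>M distr V (\<mu> \<Otimes>\<^sub>M \<mu>) (\<lambda>y. (y i, y k))"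
      by (simp add: pairV)
    also have "\<dots> = distr (\<tau> \<Otimes>\<^sub>M V) (\<tau> \<Otimes>\<^sub>M (\<mu> \<Otimes>\<^sub>M \<mu>)) (\<lambda>(t, y). (t, y i, y k))"
      using \<mu>\<mu>.sigma_finite_measure_axioms by (intro pair_measure_distr) (simp_all add: pairV)
    finally have prod_eq: "distr (\<tau> \<Otimes>\<^sub>M V) (\<tau> \<Otimes>\<^sub>M (\<mu> \<Otimes>\<^sub>M \<mu>)) (\<lambda>(t, y). (t, y i, y k))
        = \<tau> \<Otimes>\<^sub>M (\<mu> \<Otimes>\<^sub>M \<mu>)" ..
    have swap: "(\<lambda>(t, x, x'). residual_swap j (f t) x x') \<in> borel_measurable (\<tau> \<Otimes>\<^sub>M (\<mu> \<Otimes>\<^sub>M \<mu>))"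
      unfolding case_prod_beta by (intro measurable_residual_swap[OF f]) measurable
    have pick: "(\<lambda>(t, y). (t, y i, y k)) \<in> measurable (\<tau> \<Otimes>\<^sub>M V) (\<tau> \<Otimes>\<^sub>M (\<mu> \<Otimes>\<^sub>M \<mu>))"
      unfolding case_prod_beta by (intro measurable_Pair measurable_fst measurable_compose[OF measurable_snd comp])
    have "empirical_law \<tau> \<mu> j f = distr (distr (\<tau> \<Otimes>\<^sub>M V) (\<tau> \<Otimes>\<^sub>M (\<mu> \<Otimes>\<^sub>M \<mu>)) (\<lambda>(t, y). (t, y i, y k)))
        borel (\<lambda>(t, x, x'). residual_swap j (f t) x x')"
      unfolding empirical_law_def prod_eq ..
    also have "\<dots> = distr (\<tau> \<Otimes>\<^sub>M V) borel (\<lambda>(t, y). residual_swap j (f t) (y i) (y k))"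
      unfolding distr_distr[OF swap pick] by (simp add: comp_def case_prod_unfold)
    finally show ?thesis ..
  qed
  have swap_eq: "distr M borel (\<lambda>\<omega>. residual_swap j (f (T \<omega>)) (x i \<omega>) (x (\<sigma> \<omega> i) \<omega>))
      = distr M borel (\<lambda>\<omega>. h (\<sigma> \<omega>, T \<omega>, \<lambda>k\<in>{..<m}. x k \<omega>))"
  proof (rule distr_cong)
    fix \<omega> assume "\<omega> \<in> space M"
    then have "\<sigma> \<omega> permutes {..<m}"
      using measurable_space[OF \<sigma>] by (simp add: \<Theta>_def)
    then show "residual_swap j (f (T \<omega>)) (x i \<omega>) (x (\<sigma> \<omega> i) \<omega>) = h (\<sigma> \<omega>, T \<omega>, \<lambda>k\<in>{..<m}. x k \<omega>)"
      using i permutes_in_image[of "\<sigma> \<omega>" "{..<m}" i] by (simp add: h_def)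
  qed auto
  have moved': "AE \<pi> in distr M \<Theta> \<sigma>. \<pi> i \<noteq> i"
    using moved by (subst AE_distr_iff[OF \<sigma>]) (auto simp: \<Theta>_def)
  show ?thesis
    unfolding swap_eq \<mu>_def[symmetric] \<tau>_def[symmetric]
  proof (rule measure_eqI)
    fix A assume "A \<in> sets (distr M borel (\<lambda>\<omega>. h (\<sigma> \<omega>, T \<omega>, \<lambda>k\<in>{..<m}. x k \<omega>)))"
    then have A[measurable]: "A \<in> sets borel" by simp
    have "distr M borel (\<lambda>\<omega>. h (\<sigma> \<omega>, T \<omega>, \<lambda>k\<in>{..<m}. x k \<omega>)) = distr (distr M \<Theta> \<sigma> \<Otimes>\<^sub>M (\<tau> \<Otimes>\<^sub>M V)) borel h"
      unfolding joint[symmetric] by (subst distr_distr) (simp_all add: comp_def)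
    also have "emeasure \<dots> A = emeasure (distr M \<Theta> \<sigma> \<Otimes>\<^sub>M (\<tau> \<Otimes>\<^sub>M V))
        (h -` A \<inter> space (distr M \<Theta> \<sigma> \<Otimes>\<^sub>M (\<tau> \<Otimes>\<^sub>M V)))"
      by (rule emeasure_distr) simp_all
    also have "\<dots> = (\<integral>\<^sup>+\<pi>. emeasure (\<tau> \<Otimes>\<^sub>M V)
        (Pair \<pi> -` (h -` A \<inter> space (distr M \<Theta> \<sigma> \<Otimes>\<^sub>M (\<tau> \<Otimes>\<^sub>M V)))) \<partial>distr M \<Theta> \<sigma>)"
      by (rule \<tau>V.emeasure_pair_measure_alt) measurable
    also have "\<dots> = (\<integral>\<^sup>+\<pi>. emeasure (empirical_law \<tau> \<mu> j f) A \<partial>distr M \<Theta> \<sigma>)"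
    proof (rule nn_integral_cong_AE)
      show "AE \<pi> in distr M \<Theta> \<sigma>. emeasure (\<tau> \<Otimes>\<^sub>M V)
          (Pair \<pi> -` (h -` A \<inter> space (distr M \<Theta> \<sigma> \<Otimes>\<^sub>M (\<tau> \<Otimes>\<^sub>M V)))) = emeasure (empirical_law \<tau> \<mu> j f) A"
        using moved' AE_space
      proof eventually_elim
        fix \<pi> assume \<pi>: "\<pi> i \<noteq> i" and sp: "\<pi> \<in> space (distr M \<Theta> \<sigma>)"
        then have "\<pi> permutes {..<m}" by (simp add: \<Theta>_def)
        then have k: "\<pi> i < m"
          using i permutes_in_image[of \<pi> "{..<m}" i] by simp
        have meas: "(\<lambda>(t, y). residual_swap j (f t) (y i) (y (\<pi> i))) \<in> borel_measurable (\<tau> \<Otimes>\<^sub>M V)"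
          using fixed[OF k] by measurable
        have "Pair \<pi> -` (h -` A \<inter> space (distr M \<Theta> \<sigma> \<Otimes>\<^sub>M (\<tau> \<Otimes>\<^sub>M V)))
            = (\<lambda>(t, y). residual_swap j (f t) (y i) (y (\<pi> i))) -` A \<inter> space (\<tau> \<Otimes>\<^sub>M V)"
          using sp by (auto simp: h_def space_pair_measure)
        then show "emeasure (\<tau> \<Otimes>\<^sub>M V)
            (Pair \<pi> -` (h -` A \<inter> space (distr M \<Theta> \<sigma> \<Otimes>\<^sub>M (\<tau> \<Otimes>\<^sub>M V)))) = emeasure (empirical_law \<tau> \<mu> j f) A"
          by (simp add: slice[OF k \<pi>, symmetric] emeasure_distr[OF meas A])
      qed
    qed
    also have "\<dots> = emeasure (empirical_law \<tau> \<mu> j f) A"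
      using law_\<sigma>.emeasure_space_1 by simp
    finally show "emeasure (distr M borel (\<lambda>\<omega>. h (\<sigma> \<omega>, T \<omega>, \<lambda>k\<in>{..<m}. x k \<omega>))) A
        = emeasure (empirical_law \<tau> \<mu> j f) A" .
  qed (simp add: empirical_law_def)
qed

section \<open>The Wasserstein bound\<close>

lemma ennreal_sqrt_mono:
  assumes "a \<le> b" shows "ennreal_sqrt a \<le> ennreal_sqrt b"
proof (cases "b = \<infinity>")
  case False
  then have "a \<noteq> \<infinity>" and "enn2real a \<le> enn2real b"
    using assms by (auto simp: top_unique less_top intro!: enn2real_mono)
  then show ?thesis
    using False by (simp add: ennreal_sqrt_def ennreal_leI)
qed (simp add: ennreal_sqrt_def)

lemma ennreal_sqrt_tendsto_0:
  assumes "(c \<longlongrightarrow> 0) F"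
  shows "((\<lambda>n. ennreal_sqrt (c n)) \<longlongrightarrow> 0) F"
proof -
  have "((\<lambda>n. enn2real (c n)) \<longlongrightarrow> enn2real 0) F"
    using assms by (intro tendsto_enn2real) simp_all
  then have "((\<lambda>n. ennreal (sqrt (enn2real (c n)))) \<longlongrightarrow> ennreal (sqrt 0)) F"
    by (intro tendsto_ennrealI tendsto_real_sqrt) simp
  moreover have "\<forall>\<^sub>F n in F. ennreal (sqrt (enn2real (c n))) = ennreal_sqrt (c n)"
    using order_tendstoD(2)[OF assms, of top] by (auto elim!: eventually_mono simp: ennreal_sqrt_def)
  ultimately show ?thesis
    using tendsto_cong by force
qed

lemma wasserstein2_le:
  assumes "\<gamma> \<in> couplings P Q" and "(\<integral>\<^sup>+z. ennreal ((dist (fst z) (snd z))\<^sup>2) \<partial>\<gamma>) \<le> c"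
  shows "wasserstein2 P Q \<le> ennreal_sqrt c"
  unfolding wasserstein2_def using assms by (intro ennreal_sqrt_mono) (auto intro: INF_lower2)

lemma dist_residual_swap:
  "dist (residual_swap j g x x') (residual_swap j g' x x')
    = \<bar>(g (drop_coord j x) - g' (drop_coord j x)) - (g (drop_coord j x') - g' (drop_coord j x'))\<bar>"
proof -
  have "residual_swap j g x x' - residual_swap j g' x x'
      = axis j ((g (drop_coord j x) - g' (drop_coord j x)) - (g (drop_coord j x') - g' (drop_coord j x')))"
    by (simp add: vec_eq_iff residual_swap_def set_coord_def axis_def)
  then show ?thesis
    by (simp add: dist_norm norm_eq_sqrt_inner inner_axis_axis)
qed

text \<open>
  The bound behind the convergence: if replacing \<open>f t\<close> by \<open>g\<close> in the swap leads to the law \<open>Q\<close>,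
  then \<open>Q\<close> is close to the empirical law as soon as \<open>f t\<close> is close to \<open>g\<close> in mean square.
\<close>

lemma wasserstein2_empirical_le:
  fixes \<mu> :: "(real ^ 'p::finite) measure"
  assumes "prob_space \<tau>" "prob_space \<mu>" and sets_\<mu>[measurable_cong]: "sets \<mu> = sets borel"
    and f[measurable]: "case_prod f \<in> borel_measurable (\<tau> \<Otimes>\<^sub>M others j)"
    and g[measurable]: "g \<in> borel_measurable (others j)"
    and Q: "distr (\<mu> \<Otimes>\<^sub>M \<mu>) borel (\<lambda>(x, x'). residual_swap j g x x') = Q"
  shows "wasserstein2 (empirical_law \<tau> \<mu> j f) Q
    \<le> ennreal_sqrt (4 * (\<integral>\<^sup>+(t, x). ennreal ((f t (drop_coord j x) - g (drop_coord j x))\<^sup>2) \<partial>(\<tau> \<Otimes>\<^sub>M \<mu>)))"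
proof -
  interpret \<tau>: prob_space \<tau> by fact
  interpret \<mu>: prob_space \<mu> by fact
  interpret \<mu>\<mu>: pair_prob_space \<mu> \<mu> ..
  interpret R: pair_prob_space \<tau> "\<mu> \<Otimes>\<^sub>M \<mu>" ..
  define R where "R = \<tau> \<Otimes>\<^sub>M (\<mu> \<Otimes>\<^sub>M \<mu>)"
  define err where "err t x = f t (drop_coord j x) - g (drop_coord j x)" for t x
  define c where "c = (\<integral>\<^sup>+(t, x). ennreal ((err t x)\<^sup>2) \<partial>(\<tau> \<Otimes>\<^sub>M \<mu>))"
  define F where "F = (\<lambda>(t, x, x'). residual_swap j (f t) x x')"
  define G where "G = (\<lambda>(t :: 'a, x, x'). residual_swap j g x x')"
  have [measurable]: "F \<in> borel_measurable R"
    unfolding F_def R_def case_prod_beta by (intro measurable_residual_swap[OF f]) measurable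
  have swap_g[measurable]: "(\<lambda>(x, x'). residual_swap j g x x') \<in> borel_measurable (\<mu> \<Otimes>\<^sub>M \<mu>)"
    unfolding residual_swap_def set_coord_eq_join by measurable
  have [measurable]: "G \<in> borel_measurable R"
    unfolding G_def R_def residual_swap_def set_coord_eq_join by measurable
  have err[measurable]: "(\<lambda>(t, x). ennreal ((err t x)\<^sup>2)) \<in> borel_measurable (\<tau> \<Otimes>\<^sub>M \<mu>)"
    unfolding err_def by measurable
  define \<gamma> where "\<gamma> = distr R (borel \<Otimes>\<^sub>M borel) (\<lambda>z. (F z, G z))"
  have "distr R borel G = distr (distr R (\<mu> \<Otimes>\<^sub>M \<mu>) snd) borel (\<lambda>(x, x'). residual_swap j g x x')"
    by (subst distr_distr) (simp_all add: R_def G_def comp_def case_prod_unfold)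
  also have "distr R (\<mu> \<Otimes>\<^sub>M \<mu>) snd = \<mu> \<Otimes>\<^sub>M \<mu>"
    unfolding R_def by (rule distr_pair_prob_snd) unfold_locales
  finally have distr_G: "distr R borel G = Q"
    by (simp add: Q)
  have \<gamma>: "\<gamma> \<in> couplings (empirical_law \<tau> \<mu> j f) Q"
    unfolding couplings_def \<gamma>_def
    by (auto simp: distr_distr comp_def distr_G R_def[symmetric] empirical_law_def F_def[symmetric]
        intro!: prob_space.prob_space_distr R.prob_space_axioms[folded R_def])
  \<comment> \<open>Both observations have law \<open>\<mu>\<close>, so both estimation errors have the same second moment.\<close>
  have marginal: "(\<integral>\<^sup>+z. ennreal ((err (fst z) (p (snd z)))\<^sup>2) \<partial>R) = c"
    if [measurable]: "p \<in> measurable (\<mu> \<Otimes>\<^sub>M \<mu>) \<mu>" and p: "distr (\<mu> \<Otimes>\<^sub>M \<mu>) \<mu> p = \<mu>" for p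
  proof -
    have "\<tau> \<Otimes>\<^sub>M \<mu> = distr \<tau> \<tau> (\<lambda>t. t) \<Otimes>\<^sub>M distr (\<mu> \<Otimes>\<^sub>M \<mu>) \<mu> p"
      by (simp add: p)
    also have "\<dots> = distr R (\<tau> \<Otimes>\<^sub>M \<mu>) (\<lambda>(t, u). (t, p u))"
      unfolding R_def using \<mu>.sigma_finite_measure_axioms
      by (intro pair_measure_distr) (simp_all add: p)
    finally have "\<tau> \<Otimes>\<^sub>M \<mu> = distr R (\<tau> \<Otimes>\<^sub>M \<mu>) (\<lambda>(t, u). (t, p u))" .
    then have "c = (\<integral>\<^sup>+(t, x). ennreal ((err t x)\<^sup>2) \<partial>distr R (\<tau> \<Otimes>\<^sub>M \<mu>) (\<lambda>(t, u). (t, p u)))"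
      by (simp add: c_def)
    also have "\<dots> = (\<integral>\<^sup>+z. ennreal ((err (fst z) (p (snd z)))\<^sup>2) \<partial>R)"
      using err by (subst nn_integral_distr) (simp_all add: R_def case_prod_beta)
    finally show ?thesis ..
  qed
  have err_R[measurable]: "(\<lambda>z. ennreal ((err (fst z) (p (snd z)))\<^sup>2)) \<in> borel_measurable R"
    if "p \<in> measurable (\<mu> \<Otimes>\<^sub>M \<mu>) \<mu>" for p
  proof -
    have "(\<lambda>z. (fst z, p (snd z))) \<in> measurable R (\<tau> \<Otimes>\<^sub>M \<mu>)"
      unfolding R_def by (intro measurable_Pair measurable_fst measurable_compose[OF measurable_snd that])
    from measurable_compose[OF this err] show ?thesis
      by simp
  qed
  have "(\<integral>\<^sup>+z. ennreal ((dist (fst z) (snd z))\<^sup>2) \<partial>\<gamma>) = (\<integral>\<^sup>+z. ennreal ((dist (F z) (G z))\<^sup>2) \<partial>R)"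
    unfolding \<gamma>_def by (subst nn_integral_distr) simp_all
  also have "\<dots> \<le> (\<integral>\<^sup>+(t, x, x'). 2 * ennreal ((err t x)\<^sup>2) + 2 * ennreal ((err t x')\<^sup>2) \<partial>R)"
  proof (rule nn_integral_mono)
    fix z :: "'a \<times> (real ^ 'p) \<times> (real ^ 'p)"
    obtain t x x' where z: "z = (t, x, x')" by (metis prod.exhaust)
    have "(a - b)\<^sup>2 \<le> 2 * a\<^sup>2 + 2 * b\<^sup>2" for a b :: real
      using zero_le_power2[of "a + b"] by (simp add: power2_eq_square algebra_simps)
    from ennreal_leI[OF this[of "err t x" "err t x'"]]
    have "ennreal ((err t x - err t x')\<^sup>2) \<le> 2 * ennreal ((err t x)\<^sup>2) + 2 * ennreal ((err t x')\<^sup>2)"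
      by (simp add: ennreal_mult)
    then show "ennreal ((dist (F z) (G z))\<^sup>2)
        \<le> (case z of (t, x, x') \<Rightarrow> 2 * ennreal ((err t x)\<^sup>2) + 2 * ennreal ((err t x')\<^sup>2))"
      by (simp add: z F_def G_def dist_residual_swap err_def)
  qed
  also have "\<dots> = 2 * c + 2 * c"
    unfolding case_prod_beta
    using marginal[of fst] marginal[of snd] \<mu>.distr_pair_fst[of \<mu>]
      distr_pair_prob_snd[OF \<mu>.prob_space_axioms \<mu>.sigma_finite_measure_axioms]
      err_R[OF measurable_fst] err_R[OF measurable_snd]
    by (simp add: nn_integral_add nn_integral_cmult)
  also have "\<dots> = 4 * c"
    by (simp flip: distrib_right)
  finally show ?thesis
    using wasserstein2_le[OF \<gamma>] by (simp add: c_def err_def)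
qed

theorem proposition3p3:
  fixes M :: "'w measure"
    and X :: "'w \<Rightarrow> real ^ 'p::finite"
    and j :: 'p
    and \<nu> :: "'p \<Rightarrow> ('p \<Rightarrow> real) \<Rightarrow> real"
    and \<epsilon> :: "'p \<Rightarrow> 'w \<Rightarrow> real"
    and \<kappa> :: "('p \<Rightarrow> real) \<Rightarrow> real measure"
    and S :: "'s measure"
    and T :: "nat \<Rightarrow> 'w \<Rightarrow> nat \<Rightarrow> 's"
    and nuhat :: "nat \<Rightarrow> (nat \<Rightarrow> 's) \<Rightarrow> ('p \<Rightarrow> real) \<Rightarrow> real"
  assumes "prob_space M"
    and X: "X \<in> borel_measurable M"
    and innovation: "additive_innovation M X \<nu> \<epsilon>"
    and cond_law: "regular_conditional_law M X j \<kappa>"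
    and training: "\<And>n. indep_elements M (training_space S n) (T n) borel X"
    and estimator: "\<And>n. case_prod (nuhat n) \<in> borel_measurable (training_space S n \<Otimes>\<^sub>M others j)"
    and consistent:
      "(\<lambda>n. \<integral>\<^sup>+\<omega>. ennreal ((nuhat n (T n \<omega>) (drop_coord j (X \<omega>)) - \<nu> j (drop_coord j (X \<omega>)))\<^sup>2) \<partial>M)
         \<longlonglongrightarrow> 0"
  defines "P' \<equiv> \<lambda>n. empirical_law (distr M (training_space S n) (T n)) (distr M borel X) j (nuhat n)"
    and "Pstar \<equiv> theoretical_law (distr M borel X) j \<kappa>"
  shows
    "(\<forall>n m (x :: nat \<Rightarrow> 'w \<Rightarrow> real ^ 'p) (\<sigma> :: 'w \<Rightarrow> nat \<Rightarrow> nat) i.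
        prob_space.indep_vars M (\<lambda>_. borel) x {..<m} \<longrightarrow>
        (\<forall>k<m. distr M borel (x k) = distr M borel X) \<longrightarrow>
        indep_elements M (training_space S n) (T n)
          (Pi\<^sub>M {..<m} (\<lambda>_. borel)) (\<lambda>\<omega>. \<lambda>k\<in>{..<m}. x k \<omega>) \<longrightarrow>
        indep_elements M (count_space {\<pi>. \<pi> permutes {..<m}}) \<sigma>
          (training_space S n \<Otimes>\<^sub>M Pi\<^sub>M {..<m} (\<lambda>_. borel)) (\<lambda>\<omega>. (T n \<omega>, \<lambda>k\<in>{..<m}. x k \<omega>)) \<longrightarrow>
        i < m \<longrightarrow> (AE \<omega> in M. \<sigma> \<omega> i \<noteq> i) \<longrightarrow>
        distr M borel (\<lambda>\<omega>. residual_swap j (nuhat n (T n \<omega>)) (x i \<omega>) (x (\<sigma> \<omega> i) \<omega>)) = P' n) \<and>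
     (\<lambda>n. wasserstein2 (P' n) Pstar) \<longlonglongrightarrow> 0"
proof (intro conjI allI impI)
  fix n m and x :: "nat \<Rightarrow> 'w \<Rightarrow> real ^ 'p" and \<sigma> :: "'w \<Rightarrow> nat \<Rightarrow> nat" and i
  assume "prob_space.indep_vars M (\<lambda>_. borel) x {..<m}"
    and "\<forall>k<m. distr M borel (x k) = distr M borel X"
    and "indep_elements M (training_space S n) (T n)
          (Pi\<^sub>M {..<m} (\<lambda>_. borel)) (\<lambda>\<omega>. \<lambda>k\<in>{..<m}. x k \<omega>)"
    and "indep_elements M (count_space {\<pi>. \<pi> permutes {..<m}}) \<sigma>
          (training_space S n \<Otimes>\<^sub>M Pi\<^sub>M {..<m} (\<lambda>_. borel)) (\<lambda>\<omega>. (T n \<omega>, \<lambda>k\<in>{..<m}. x k \<omega>))"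
    and "i < m" and "AE \<omega> in M. \<sigma> \<omega> i \<noteq> i"
  then show "distr M borel (\<lambda>\<omega>. residual_swap j (nuhat n (T n \<omega>)) (x i \<omega>) (x (\<sigma> \<omega> i) \<omega>)) = P' n"
    unfolding P'_def by (intro residual_swap_permuted_law[OF \<open>prob_space M\<close> X estimator])
next
  interpret prob_space M by fact
  define mse where "mse n = (\<integral>\<^sup>+\<omega>. ennreal ((nuhat n (T n \<omega>) (drop_coord j (X \<omega>))
      - \<nu> j (drop_coord j (X \<omega>)))\<^sup>2) \<partial>M)" for n
  have \<nu>[measurable]: "\<nu> j \<in> borel_measurable (others j)"
    using innovation by (simp add: additive_innovation_def)
  have bound: "wasserstein2 (P' n) Pstar \<le> ennreal_sqrt (4 * mse n)" for n
  proof -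
    have T[measurable]: "T n \<in> measurable M (training_space S n)"
      using training[of n] by (simp add: indep_elements_def)
    note [measurable] = X estimator[of n]
    have mse_eq: "(\<integral>\<^sup>+(t, x). ennreal ((nuhat n t (drop_coord j x) - \<nu> j (drop_coord j x))\<^sup>2)
        \<partial>(distr M (training_space S n) (T n) \<Otimes>\<^sub>M distr M borel X)) = mse n"
      unfolding indep_elements_distr_pair[OF \<open>prob_space M\<close> training, symmetric] mse_def
      by (subst nn_integral_distr) (simp_all add: case_prod_beta)
    show ?thesis
      unfolding P'_def Pstar_def theoretical_law_eq[OF \<open>prob_space M\<close> X cond_law] mse_eq[symmetric]
      by (intro wasserstein2_empirical_le prob_space_distr
          residual_swap_innovation_law[OF \<open>prob_space M\<close> X innovation]) simp_all
  qed
  have "(\<lambda>n. 4 * mse n) \<longlonglongrightarrow> 4 * 0"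
    using consistent unfolding mse_def by (intro ennreal_tendsto_cmult) simp_all
  then have lim: "(\<lambda>n. ennreal_sqrt (4 * mse n)) \<longlonglongrightarrow> 0"
    by (intro ennreal_sqrt_tendsto_0) simp
  show "(\<lambda>n. wasserstein2 (P' n) Pstar) \<longlonglongrightarrow> 0"
    by (rule tendsto_sandwich[OF _ _ tendsto_const lim]) (simp_all add: bound)
qed

end
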